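(* Let $L$ be a right Leibniz algebra over a field which is also a left Leibniz algebra. Then $L$ is dextral symmetric if and only if it is anti-associative.
   Context: Let $L$ be a vector space over a field with a bilinear bracket $[\,,]:L\times L\to L$. $L$ is a right Leibniz algebra if $[a,[b,c]]=[[a,b],c]-[[a,c],b]$ for all $a,b,c\in L$, and a left Leibniz algebra if $[a,[b,c]]=[[a,b],c]+[b,[a,c]]$ for all $a,b,c\in L$. $L$ is dextral symmetric if for all $a,b,c\in L$, $[a,[b,c]]=0$ implies $[b,[a,c]]=0$. $L$ is anti-associative if $[x,[y,z]]=-[[x,y],z]$ for all $x,y,z\in L$. *)

theory Defs
  imports Complex_Main
begin

text \<open>The vector space is the whole type \<open>'v\<close>, with scalar multiplication \<open>scale\<close> by the
  field \<open>'k\<close>; no assumption is made on dimension or characteristic.\<close>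

locale bracket_algebra = vector_space scale
  for scale :: "'k::field \<Rightarrow> 'v::ab_group_add \<Rightarrow> 'v" +
  fixes bracket :: "'v \<Rightarrow> 'v \<Rightarrow> 'v"
  assumes linear_right: "\<And>a. Vector_Spaces.linear scale scale (\<lambda>b. bracket a b)"
    and linear_left: "\<And>b. Vector_Spaces.linear scale scale (\<lambda>a. bracket a b)"

locale right_leibniz_algebra = bracket_algebra scale bracket
  for scale :: "'k::field \<Rightarrow> 'v::ab_group_add \<Rightarrow> 'v" and bracket :: "'v \<Rightarrow> 'v \<Rightarrow> 'v" +
  assumes right_leibniz:
    "\<And>a b c. bracket a (bracket b c) = bracket (bracket a b) c - bracket (bracket a c) b"

locale left_leibniz_algebra = bracket_algebra scale bracket
  for scale :: "'k::field \<Rightarrow> 'v::ab_group_add \<Rightarrow> 'v" and bracket :: "'v \<Rightarrow> 'v \<Rightarrow> 'v" +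
  assumes left_leibniz:
    "\<And>a b c. bracket a (bracket b c) = bracket (bracket a b) c + bracket b (bracket a c)"

definition dextral_symmetric :: "('v::ab_group_add \<Rightarrow> 'v \<Rightarrow> 'v) \<Rightarrow> bool" where
  "dextral_symmetric bracket \<longleftrightarrow>
    (\<forall>a b c. bracket a (bracket b c) = 0 \<longrightarrow> bracket b (bracket a c) = 0)"

definition anti_associative :: "('v::ab_group_add \<Rightarrow> 'v \<Rightarrow> 'v) \<Rightarrow> bool" where
  "anti_associative bracket \<longleftrightarrow>
    (\<forall>x y z. bracket x (bracket y z) = - bracket (bracket x y) z)"

end

theory Submission
  imports Defs
begin

text \<open>
  Comparing the two Leibniz identities gives \<open>(ab)c = - c(ab)\<close>. The right identity gives
  \<open>a(bb) = 0\<close>, so dextral symmetry gives \<open>b(ab) = 0\<close>; by linearisation \<open>a(bc)\<close> is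
  antisymmetric under two transpositions, hence invariant under cyclic rotation, and
  \<open>(ab)c = - c(ab) = - a(bc)\<close>. Conversely, anti-associativity turns the left identity into
  \<open>b(ac) = 2 a(bc)\<close>.
\<close>

context bracket_algebra
begin

lemma bracket_add_right: "bracket a (b + c) = bracket a b + bracket a c"
  by (rule Vector_Spaces.linear.axioms(3)[OF linear_right, THEN module_hom.add])

lemma bracket_add_left: "bracket (a + b) c = bracket a c + bracket b c"
  by (rule Vector_Spaces.linear.axioms(3)[OF linear_left, THEN module_hom.add])

end

lemma (in left_leibniz_algebra) anti_associative_imp_dextral_symmetric:
  assumes "anti_associative bracket"
  shows "dextral_symmetric bracket"
  unfolding dextral_symmetric_def
proof (intro allI impI)
  fix a b c
  assume zero: "bracket a (bracket b c) = 0"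
  then have "bracket (bracket a b) c = 0"
    using assms by (metis anti_associative_def neg_equal_0_iff_equal)
  \<comment> \<open>Two of the three terms of the left identity for \<open>a\<close>,
    \<open>b\<close>, \<open>c\<close> now vanish, hence so does the third.\<close>
  with zero show "bracket b (bracket a c) = 0"
    by (metis left_leibniz add_0)
qed

context right_leibniz_algebra
begin

lemma bracket_square: "bracket a (bracket b b) = 0"
  using right_leibniz[of a b b] by simp

text \<open>Exchanging \<open>b\<close> and \<open>c\<close> negates the right-hand side of the
  right identity.\<close>

lemma bracket_swap_right: "bracket a (bracket b c) = - bracket a (bracket c b)"
  using right_leibniz[of a b c] right_leibniz[of a c b] by simp

lemma dextral_symmetric_bracket_swap_outer:
  assumes "dextral_symmetric bracket"
  shows "bracket a (bracket b c) = - bracket c (bracket b a)"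
proof -
  have zero: "bracket x (bracket b x) = 0" for x
    using assms bracket_square[of b x] by (auto simp: dextral_symmetric_def)
  \<comment> \<open>Polarisation of \<open>zero\<close> at \<open>x = a + c\<close>: only the mixed
    terms survive on the right, and the left side vanishes too.\<close>
  have "bracket (a + c) (bracket b (a + c)) = bracket a (bracket b c) + bracket c (bracket b a)"
    by (simp add: bracket_add_left bracket_add_right zero)
  then show ?thesis
    by (simp add: zero eq_neg_iff_add_eq_0)
qed

text \<open>A rotation is a product of two transpositions, so the two signs cancel.\<close>

lemma dextral_symmetric_bracket_rotate:
  assumes "dextral_symmetric bracket"
  shows "bracket c (bracket a b) = bracket a (bracket b c)"
  using dextral_symmetric_bracket_swap_outer[OF assms, of a b c] bracket_swap_right[of c b a]
  by simp

end

theorem theorem4p2: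
  fixes scale :: "'k::field \<Rightarrow> 'v::ab_group_add \<Rightarrow> 'v"
    and bracket :: "'v \<Rightarrow> 'v \<Rightarrow> 'v"
  assumes "right_leibniz_algebra scale bracket"
    and "left_leibniz_algebra scale bracket"
  shows "dextral_symmetric bracket \<longleftrightarrow> anti_associative bracket"
proof
  interpret R: right_leibniz_algebra scale bracket by fact
  interpret L: left_leibniz_algebra scale bracket by fact
  show "dextral_symmetric bracket" if "anti_associative bracket"
    using that by (rule L.anti_associative_imp_dextral_symmetric)
  show "anti_associative bracket" if dextral: "dextral_symmetric bracket"
    unfolding anti_associative_def
  proof (intro allI)
    fix x y z
    \<comment> \<open>Both identities expand \<open>bracket x (bracket z y)\<close> and share the
      term \<open>bracket (bracket x z) y\<close>; the remaining terms must agree.\<close>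
    have "bracket (bracket x y) z = - bracket z (bracket x y)"
      using R.right_leibniz[of x z y] L.left_leibniz[of x z y]
      by (simp add: eq_neg_iff_add_eq_0 algebra_simps)
    also have "\<dots> = - bracket x (bracket y z)"
      using R.dextral_symmetric_bracket_rotate[OF dextral, of z x y] by simp
    finally show "bracket x (bracket y z) = - bracket (bracket x y) z"
      by simp
  qed
qed

end
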